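(* Let $p$ be an ultrafilter on $\mathbb{N}$. If $p$ is strongly summable, then $p$ is rapid.
   Context: $\mathbb{N}=\{1,2,3,\dots\}$ is the set of positive integers and $\omega=\{0,1,2,\dots\}$. The semigroup under consideration is $(\mathbb{N},+)$. FS-set: for a sequence $(x_n)_{n\in\omega}$ in $\mathbb{N}$, put $$FS(x_n)=\Big\{\sum_{n\in s}x_n : s\subseteq\omega \text{ finite},\ s\neq\emptyset\Big\}.$$ A set of this form is called an FS-set. Strongly summable: an ultrafilter $p$ on $\mathbb{N}$ is strongly summable if it has a base of FS-sets, i.e. for every $A\in p$ there is a sequence $(x_n)_{n\in\omega}$ in $\mathbb{N}$ with $FS(x_n)\subseteq A$ and $FS(x_n)\in p$. Rapid: an ultrafilter $p$ on $\mathbb{N}$ is rapid if for every function $f:\mathbb{N}\to\mathbb{N}$ there exists $A\in p$ such that $|A\cap f(i)|<i$ for all $i\in\mathbb{N}$, where the natural number $f(i)$ is identified with the set of its predecessors, so that $A\cap f(i)=\{a\in A: a<f(i)\}$. *)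

theory Defs
  imports Complex_Main
begin

abbreviation pos_nats :: "nat set"
  where "pos_nats \<equiv> {1..}"

text \<open>
  Filters on a set \<open>X\<close> are represented by those filters on the ambient type that contain \<open>X\<close>;
  a subset \<open>A\<close> of \<open>X\<close> belongs to the filter \<open>p\<close> iff \<open>\<forall>\<^sub>F x in p. x \<in> A\<close>.
\<close>

definition ultrafilter_on :: "'a set \<Rightarrow> 'a filter \<Rightarrow> bool"
  where "ultrafilter_on X p \<longleftrightarrow>
    p \<noteq> bot \<and> (\<forall>\<^sub>F x in p. x \<in> X) \<and>
    (\<forall>A\<subseteq>X. (\<forall>\<^sub>F x in p. x \<in> A) \<or> (\<forall>\<^sub>F x in p. x \<in> X - A))"

definition FS :: "(nat \<Rightarrow> nat) \<Rightarrow> nat set"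
  where "FS x = {\<Sum>n\<in>s. x n | s. finite s \<and> s \<noteq> {}}"

definition strongly_summable :: "nat filter \<Rightarrow> bool"
  where "strongly_summable p \<longleftrightarrow>
    (\<forall>A\<subseteq>pos_nats. (\<forall>\<^sub>F n in p. n \<in> A) \<longrightarrow>
      (\<exists>x :: nat \<Rightarrow> nat. (\<forall>n. x n \<in> pos_nats) \<and> FS x \<subseteq> A \<and> (\<forall>\<^sub>F n in p. n \<in> FS x)))"

definition rapid :: "nat filter \<Rightarrow> bool"
  where "rapid p \<longleftrightarrow>
    (\<forall>f :: nat \<Rightarrow> nat. (\<forall>i\<in>pos_nats. f i \<in> pos_nats) \<longrightarrow>
      (\<exists>A\<subseteq>pos_nats. (\<forall>\<^sub>F n in p. n \<in> A) \<and> (\<forall>i\<in>pos_nats. card {a \<in> A. a < f i} < i)))"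

end

theory Submission
  imports Defs "HOL-Computational_Algebra.Primes" "HOL-Library.Discrete_Functions"
begin

text \<open>
  Let \<open>v n\<close> be the 3-adic valuation of \<open>n\<close> and colour \<open>n\<close> by its last nonzero ternary digit. If
  \<open>FS x\<close> is monochromatic, then the \<open>v (x j)\<close> are pairwise distinct, because adding two numbers with
  the same valuation and the same last nonzero digit changes that digit. Given \<open>f\<close>, let \<open>B\<close> be the
  set of all \<open>n\<close> with \<open>2 ^ (v n + 1) \<le> i\<close> whenever \<open>n < f i\<close>. The complement of \<open>B\<close> contains no
  monochromatic \<open>FS x\<close>, since the numbers \<open>x 0 + x j\<close> have bounded valuation but are themselves
  unbounded; hence \<open>B\<close> belongs to the ultrafilter. If \<open>FS x \<subseteq> B\<close> is monochromatic, then at most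
  \<open>log\<^sub>2 i\<close> indices \<open>j\<close> satisfy \<open>x j < f i\<close>, so fewer than \<open>i\<close> elements of \<open>FS x\<close> lie below \<open>f i\<close>.
\<close>

definition last_digit3 :: "nat \<Rightarrow> nat"
  where "last_digit3 n = n div 3 ^ multiplicity 3 n mod 3"

lemma last_digit3_cases:
  assumes "n > 0"
  shows "last_digit3 n = 1 \<or> last_digit3 n = 2"
proof -
  have "\<not> 3 dvd n div 3 ^ multiplicity 3 n"
    using assms by (intro multiplicity_decompose) auto
  then have "last_digit3 n \<noteq> 0"
    by (simp add: last_digit3_def dvd_eq_mod_eq_0)
  moreover have "last_digit3 n < 3"
    by (simp add: last_digit3_def)
  ultimately show ?thesis by linarith
qed

text \<open>Once the common power of 3 is divided out, both cofactors are congruent mod 3 to the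
  shared digit d, which is 1 or 2. Their sum is congruent to 2d, which is neither 0 nor d, so the
  valuation stays and the digit changes.\<close>

lemma last_digit3_add_neq:
  assumes "m > 0" "n > 0"
    and mult: "multiplicity 3 m = multiplicity 3 n"
    and digit: "last_digit3 m = last_digit3 n"
  shows "last_digit3 (m + n) \<noteq> last_digit3 m"
proof -
  define v a b where "v = multiplicity 3 n" and "a = m div 3 ^ v" and "b = n div 3 ^ v"
  have "m = 3 ^ v * a" "n = 3 ^ v * b"
    using mult multiplicity_dvd[of 3 m] multiplicity_dvd[of 3 n] by (simp_all add: v_def a_def b_def)
  then have sum: "m + n = 3 ^ v * (a + b)"
    by (simp add: algebra_simps)
  have ab: "a mod 3 = last_digit3 m" "b mod 3 = last_digit3 m"
    using mult digit by (simp_all add: last_digit3_def v_def a_def b_def)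
  have "(a + b) mod 3 = 2 * last_digit3 m mod 3"
    using ab by (simp add: mod_add_eq[of a 3 b, symmetric] mult_2)
  then have neq: "(a + b) mod 3 \<noteq> last_digit3 m" "(a + b) mod 3 \<noteq> 0"
    using last_digit3_cases[OF \<open>m > 0\<close>] by auto
  have "multiplicity 3 (m + n) = v"
    using neq(2) by (intro multiplicity_eqI) (auto simp: sum dvd_eq_mod_eq_0[symmetric])
  then show ?thesis
    using neq(1) by (simp add: last_digit3_def sum)
qed

lemma sum_in_FS: "finite s \<Longrightarrow> s \<noteq> {} \<Longrightarrow> sum x s \<in> FS x"
  unfolding FS_def by blast

lemma in_FS: "x j \<in> FS x"
  using sum_in_FS[of "{j}" x] by simp

lemma add_in_FS: "i \<noteq> j \<Longrightarrow> x i + x j \<in> FS x"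
  using sum_in_FS[of "{i, j}" x] by simp

lemma inj_multiplicity3_if_monochromatic:
  assumes pos: "\<And>j. x j > 0"
    and mono: "\<And>n. n \<in> FS x \<Longrightarrow> last_digit3 n = d"
  shows "inj (\<lambda>j. multiplicity 3 (x j))"
proof (rule injI, rule ccontr)
  fix i j
  assume mult: "multiplicity 3 (x i) = multiplicity 3 (x j)" and "i \<noteq> j"
  from \<open>i \<noteq> j\<close> have "last_digit3 (x i + x j) = d"
    by (intro mono add_in_FS)
  moreover have "last_digit3 (x i) = d" "last_digit3 (x j) = d"
    by (intro mono in_FS)+
  ultimately show False
    using last_digit3_add_neq[OF pos pos mult] by simp
qed

text \<open>When the valuations differ, the sum has the smaller of the two.\<close>

lemma multiplicity_add_le:
  fixes m n :: nat
  assumes "m > 0" "n > 0" "multiplicity 3 m \<noteq> multiplicity 3 n"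
  shows "multiplicity 3 (m + n) \<le> multiplicity 3 m"
proof (cases "multiplicity 3 m < multiplicity 3 n")
  case True
  then show ?thesis
    using assms by (simp add: multiplicity_sum_lt)
next
  case False
  then have "multiplicity 3 (n + m) = multiplicity 3 n"
    using assms by (intro multiplicity_sum_lt) auto
  with False show ?thesis
    by (simp add: add.commute)
qed

text \<open>The \<open>Suc\<close> leaves only the valuations 0, ..., k - 1 with k =
  \<open>floor_log i\<close> to elements below \<open>f i\<close>. Then k terms of distinct
  valuations have at most 2^k - 1 < i nonempty sums; the exponent without \<open>Suc\<close> would
  allow k + 1 terms, too many for this count.\<close>

definition sparse_for :: "(nat \<Rightarrow> nat) \<Rightarrow> nat set"
  where "sparse_for f = {n. \<forall>i. n < f i \<longrightarrow> 0 < i \<longrightarrow> 2 ^ Suc (multiplicity 3 n) \<le> i}"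

lemma FS_meets_sparse_for:
  assumes pos: "\<And>j. x j > 0"
    and inj: "inj (\<lambda>j. multiplicity 3 (x j))"
  shows "FS x \<inter> sparse_for f \<noteq> {}"
proof
  assume disj: "FS x \<inter> sparse_for f = {}"
  \<comment> \<open>If \<open>x 0 + x j\<close> violates sparsity at \<open>i\<close>, then
    \<open>i\<close> is below a power of 2 depending only on \<open>x 0\<close>, since adding
    \<open>x j\<close> does not raise the valuation of \<open>x 0\<close>. So \<open>N\<close>
    bounds every such \<open>f i\<close>, independently of \<open>j\<close>.\<close>
  define N where "N = Max (f ` {..2 ^ Suc (multiplicity 3 (x 0))})"
  have "x j < N" if "j \<noteq> 0" for j
  proof -
    have "x 0 + x j \<notin> sparse_for f"
      using disj add_in_FS[of 0 j x] that by auto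
    then obtain i where i: "x 0 + x j < f i" "i < 2 ^ Suc (multiplicity 3 (x 0 + x j))"
      unfolding sparse_for_def by auto
    have "multiplicity 3 (x 0) \<noteq> multiplicity 3 (x j)"
      using injD[OF inj, of 0 j] that by auto
    then have "multiplicity 3 (x 0 + x j) \<le> multiplicity 3 (x 0)"
      by (intro multiplicity_add_le pos)
    then have "(2::nat) ^ Suc (multiplicity 3 (x 0 + x j)) \<le> 2 ^ Suc (multiplicity 3 (x 0))"
      by (intro power_increasing) auto
    with i(2) have "i \<le> 2 ^ Suc (multiplicity 3 (x 0))"
      by linarith
    then have "f i \<le> N"
      unfolding N_def by (intro Max_ge) auto
    with i(1) show ?thesis by linarith
  qed
  then have "x ` (- {0}) \<subseteq> {..<N}"
    by auto
  then have "finite (x ` (- {0}))"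
    using finite_subset by blast
  moreover have "inj x"
    using inj unfolding inj_def by metis
  ultimately have "finite (- {0::nat})"
    using finite_imageD inj_on_subset by blast
  then show False
    by simp
qed

lemma card_FS_less:
  assumes inj: "inj (\<lambda>j. multiplicity 3 (x j))"
    and sparse: "FS x \<subseteq> sparse_for f"
    and "i > 0"
  shows "card {a \<in> FS x. a < f i} < i"
proof -
  define J where "J = {j. x j < f i}"
  have bound: "2 ^ Suc (multiplicity 3 (x j)) \<le> i" if "j \<in> J" for j
    using that sparse in_FS[of x j] \<open>i > 0\<close> unfolding J_def sparse_for_def by auto
  have injJ: "inj_on (\<lambda>j. multiplicity 3 (x j)) J"
    using inj inj_on_subset by blast
  define k where "k = floor_log i"
  have "multiplicity 3 (x j) < k" if "j \<in> J" for j
  proof -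
    have "floor_log (2 ^ Suc (multiplicity 3 (x j))) \<le> k"
      unfolding k_def using bound[OF that] by (intro floor_log_le_iff)
    then show ?thesis
      by (simp del: power_Suc)
  qed
  then have image: "(\<lambda>j. multiplicity 3 (x j)) ` J \<subseteq> {..<k}"
    by auto
  then have "finite J"
    using injJ finite_imageD finite_subset by blast
  have "card J \<le> k"
    using card_inj_on_le[OF injJ image] by simp
  \<comment> \<open>Each term is at most the whole sum, so a sum below \<open>f i\<close> uses only
    indices in \<open>J\<close>. Leaving out the empty index set makes the final inequality
    strict.\<close>
  have "{a \<in> FS x. a < f i} \<subseteq> sum x ` (Pow J - {{}})"
  proof
    fix a
    assume "a \<in> {a \<in> FS x. a < f i}"
    then obtain s where s: "a = sum x s" "finite s" "s \<noteq> {}" "sum x s < f i"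
      unfolding FS_def by auto
    have "x j \<le> sum x s" if "j \<in> s" for j
      using that s(2) by (intro member_le_sum) auto
    with s(4) have "s \<subseteq> J"
      unfolding J_def by (auto dest: le_less_trans)
    with s show "a \<in> sum x ` (Pow J - {{}})"
      by auto
  qed
  then have "card {a \<in> FS x. a < f i} \<le> card (Pow J - {{}})"
    using \<open>finite J\<close> by (intro surj_card_le) auto
  also have "\<dots> = 2 ^ card J - 1"
    using \<open>finite J\<close> by (simp add: card_Pow card_Diff_singleton)
  also have "\<dots> < 2 ^ card J"
    by simp
  also have "\<dots> \<le> 2 ^ k"
    using \<open>card J \<le> k\<close> by (intro power_increasing) auto
  also have "\<dots> \<le> i"
    unfolding k_def using \<open>i > 0\<close> by (rule floor_log_exp2_le)
  finally show ?thesis .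
qed

lemma strongly_summableD:
  assumes "strongly_summable p" "\<forall>\<^sub>F n in p. n \<in> A" "A \<subseteq> pos_nats"
  obtains x where "\<forall>j. x j > 0" "FS x \<subseteq> A" "\<forall>\<^sub>F n in p. n \<in> FS x"
proof -
  obtain x where "\<forall>j. x j \<in> pos_nats" "FS x \<subseteq> A" "\<forall>\<^sub>F n in p. n \<in> FS x"
    using assms unfolding strongly_summable_def by blast
  then show ?thesis
    by (intro that) (auto simp: Suc_le_eq)
qed

theorem theorem3:
  fixes p :: "nat filter"
  assumes "ultrafilter_on pos_nats p"
    and "strongly_summable p"
  shows "rapid p"
  unfolding rapid_def
proof (intro allI impI)
  fix f :: "nat \<Rightarrow> nat"
  have ultra: "(\<forall>\<^sub>F n in p. n \<in> A) \<or> (\<forall>\<^sub>F n in p. n \<in> pos_nats - A)" if "A \<subseteq> pos_nats" for A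
    using assms(1) that unfolding ultrafilter_on_def by blast
  define D where "D d = {n \<in> pos_nats. last_digit3 n = d}" for d
  have D_pos: "D d \<subseteq> pos_nats" for d
    unfolding D_def by auto
  from ultra[OF D_pos[of 1]] obtain d where D: "\<forall>\<^sub>F n in p. n \<in> D d"
  proof
    assume "\<forall>\<^sub>F n in p. n \<in> pos_nats - D 1"
    then have "\<forall>\<^sub>F n in p. n \<in> D 2"
    proof (rule eventually_mono)
      show "n \<in> D 2" if "n \<in> pos_nats - D 1" for n
        using that last_digit3_cases[of n] by (auto simp: D_def)
    qed
    then show ?thesis
      by (rule that)
  qed
  have inj: "inj (\<lambda>j. multiplicity 3 (x j))" if "\<And>j. x j > 0" "FS x \<subseteq> D d" for x
    using that by (intro inj_multiplicity3_if_monochromatic[of x d]) (auto simp: D_def)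
  define B where "B = pos_nats \<inter> sparse_for f"
  have "\<not> (\<forall>\<^sub>F n in p. n \<in> pos_nats - B)"
  proof
    assume "\<forall>\<^sub>F n in p. n \<in> pos_nats - B"
    \<comment> \<open>Intersecting with \<open>D d\<close> makes the FS-set monochromatic, which
      yields the distinct valuations needed for the contradiction.\<close>
    with D have "\<forall>\<^sub>F n in p. n \<in> D d - B"
      by eventually_elim auto
    moreover have "D d - B \<subseteq> pos_nats"
      using D_pos by auto
    ultimately obtain x where x: "\<forall>j. x j > 0" "FS x \<subseteq> D d - B" "\<forall>\<^sub>F n in p. n \<in> FS x"
      by (rule strongly_summableD[OF assms(2)])
    then have "FS x \<inter> sparse_for f = {}"
      using D_pos unfolding B_def by blast
    moreover have "FS x \<inter> sparse_for f \<noteq> {}"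
      using x by (intro FS_meets_sparse_for inj) auto
    ultimately show False
      by blast
  qed
  then have "\<forall>\<^sub>F n in p. n \<in> B"
    using ultra[of B] unfolding B_def by blast
  with D have "\<forall>\<^sub>F n in p. n \<in> D d \<inter> B"
    by eventually_elim auto
  moreover have "D d \<inter> B \<subseteq> pos_nats"
    using D_pos by auto
  ultimately obtain x where x: "\<forall>j. x j > 0" "FS x \<subseteq> D d \<inter> B" "\<forall>\<^sub>F n in p. n \<in> FS x"
    by (rule strongly_summableD[OF assms(2)])
  \<comment> \<open>The witness for rapidity is \<open>FS x\<close>, not \<open>B\<close>: sparsity
    restricts only valuations, and \<open>B\<close> may contain many elements of the same
    valuation.\<close>
  have "card {a \<in> FS x. a < f i} < i" if "i \<in> pos_nats" for i
    using x that by (intro card_FS_less inj) (auto simp: B_def)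
  moreover have "FS x \<subseteq> pos_nats"
    using x D_pos by auto
  ultimately show "\<exists>A\<subseteq>pos_nats. (\<forall>\<^sub>F n in p. n \<in> A) \<and> (\<forall>i\<in>pos_nats. card {a \<in> A. a < f i} < i)"
    using x(3) by blast
qed

end
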